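(* In the setting of the context, let $\mathcal L:\mathcal B\to\mathcal B_2$ be a continuous linear bijection onto a Banach space $(\mathcal B_2,\|\cdot\|_2)$; for $i\in\beth$ let $\mathcal B_{2,i}:=\mathcal L\mathcal B_i$ be equipped with the norm $\|\cdot\|_{2,i}$ induced from $\mathcal B_2$, and let $\mathcal L_i:\mathcal B_i\to\mathcal B_{2,i}$ be the induced bijection. Write $C_{\mathcal L},C_{\mathcal L^{-1}},C_{\mathcal L_i},C_{\mathcal L_i^{-1}}$ for the continuity constants (operator norms) of $\mathcal L,\mathcal L^{-1},\mathcal L_i,\mathcal L_i^{-1}$, and $\bar C_{\mathcal L}:=\max(C_{\mathcal L},\max_iC_{\mathcal L_i})$, $\bar C_{\mathcal L^{-1}}:=\max(C_{\mathcal L^{-1}},\max_iC_{\mathcal L_i^{-1}})$. Let $C_{\min}$ and $C_{\max}$ be (positive) constants such that for all $\varphi\in\mathcal B^*$, $$C_{\min}\inf_{\phi\in\Phi}\|\mathcal LQ(\varphi-\phi)\|_2^2\le\sum_{i\in\beth}\inf_{\phi\in\Phi}\|\mathcal L_iQ_i\mathcal R_i(\varphi-\phi)\|_{2,i}^2\le C_{\max}\inf_{\phi\in\Phi}\|\mathcal LQ(\varphi-\phi)\|_2^2.$$ Then $$\lambda_{\max}(P)\le(\bar C_{\mathcal L}\bar C_{\mathcal L^{-1}})^2C_{\max}\qquad\text{and}\qquad\lambda_{\min}(P)\ge\frac{C_{\min}}{(\bar C_{\mathcal L}\bar C_{\mathcal L^{-1}})^2}.$$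
   Context: $(\mathcal B,\|\cdot\|)$ is a reflexive separable Banach space with dual $\mathcal B^*$ and pairing $[\cdot,\cdot]$, with $\|u\|^2=[Q^{-1}u,u]$ for a symmetric positive bijective linear operator $Q:\mathcal B^*\to\mathcal B$, $\langle u,v\rangle:=[Q^{-1}u,v]$. $\aleph=\{1,\dots,|\aleph|\}$ and $\beth=\{1,\dots,|\beth|\}$ are finite index sets, $(\phi_{i,\alpha})_{(i,\alpha)\in\beth\times\aleph}$ are linearly independent elements of $\mathcal B^*$, with span $\Phi$. For $i\in\beth$, $\mathcal B_i\subset\mathcal B$ are closed subspaces with the induced norm $\|\cdot\|_i$ such that (1) $\mathcal B=\mathcal B_1+\cdots+\mathcal B_{|\beth|}$ (not necessarily direct) and (2) for each $(i,\alpha)$ there is $\tilde\psi_{i,\alpha}\in\mathcal B_i$ with $[\phi_{j,\beta},\tilde\psi_{i,\alpha}]=\delta_{i,j}\delta_{\alpha,\beta}$ for all $(j,\beta)$. $\mathfrak V^\perp:=\{\psi\in\mathcal B:[\phi_{i,\alpha},\psi]=0\ \forall(i,\alpha)\}$, $\mathfrak V^\perp_i:=\mathcal B_i\cap\mathfrak V^\perp$; $P_i$ is the $\langle\cdot,\cdot\rangle$-orthogonal projection of $\mathcal B$ onto $\mathfrak V^\perp_i$, $P:=\sum_{i\in\beth}P_i$. $\lambda_{\min}(P)$ and $\lambda_{\max}(P)$ are the largest and smallest constants with $\lambda_{\min}(P)\|\chi\|^2\le\langle\chi,P\chi\rangle\le\lambda_{\max}(P)\|\chi\|^2$ for all $\chi\in\mathfrak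 V^\perp$. $\|\varphi\|_{*,i}:=\sup_{\psi\in\mathcal B_i}[\varphi,\psi]/\|\psi\|_i$ is the dual norm on $\mathcal B_i^*$; $Q_i:\mathcal B_i^*\to\mathcal B_i$ is the positive symmetric linear bijection with $\|\varphi\|_{*,i}^2=[\varphi,Q_i\varphi]$ for $\varphi\in\mathcal B_i^*$; $\mathcal R_i:\mathcal B^*\to\mathcal B_i^*$ is restriction: $[\mathcal R_i\varphi,\psi]=[\varphi,\psi]$ for $\psi\in\mathcal B_i$. *)

theory Defs
  imports "HOL-Analysis.Analysis"
begin

text \<open>The Banach space \<open>B\<close> is a type \<open>'b\<close> of class \<open>banach\<close>, its dual is the type of bounded
  linear functionals \<open>'b \<Rightarrow>\<^sub>L real\<close>, and the pairing \<open>[\<phi>, u]\<close> is \<open>blinfun_apply \<phi> u\<close>.\<close>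

definition reflexive_space :: "'b::real_normed_vector itself \<Rightarrow> bool" where
  "reflexive_space _ \<longleftrightarrow>
     (\<forall>F :: ('b \<Rightarrow>\<^sub>L real) \<Rightarrow>\<^sub>L real. \<exists>x::'b. \<forall>f. blinfun_apply F f = blinfun_apply f x)"

definition energy_inner :: "(('b::real_normed_vector \<Rightarrow>\<^sub>L real) \<Rightarrow> 'b) \<Rightarrow> 'b \<Rightarrow> 'b \<Rightarrow> real" where
  "energy_inner Q u v = blinfun_apply (inv Q u) v"

definition measurement_span ::
    "(nat \<Rightarrow> nat \<Rightarrow> ('b::real_normed_vector \<Rightarrow>\<^sub>L real)) \<Rightarrow> nat \<Rightarrow> nat \<Rightarrow> ('b \<Rightarrow>\<^sub>L real) set" where
  "measurement_span \<phi> nb na = span ((\<lambda>(i, a). \<phi> i a) ` ({1..nb} \<times> {1..na}))"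

definition measurement_kernel ::
    "(nat \<Rightarrow> nat \<Rightarrow> ('b::real_normed_vector \<Rightarrow>\<^sub>L real)) \<Rightarrow> nat \<Rightarrow> nat \<Rightarrow> 'b set" where
  "measurement_kernel \<phi> nb na =
     {\<psi>. \<forall>i\<in>{1..nb}. \<forall>a\<in>{1..na}. blinfun_apply (\<phi> i a) \<psi> = 0}"

definition energy_proj ::
    "(('b::real_normed_vector \<Rightarrow>\<^sub>L real) \<Rightarrow> 'b) \<Rightarrow> 'b set \<Rightarrow> 'b \<Rightarrow> 'b" where
  "energy_proj Q S x = (THE y. y \<in> S \<and> (\<forall>v\<in>S. energy_inner Q (x - y) v = 0))"

definition sum_proj ::
    "(('b::real_normed_vector \<Rightarrow>\<^sub>L real) \<Rightarrow> 'b) \<Rightarrow> (nat \<Rightarrow> 'b set) \<Rightarrow> nat \<Rightarrow> 'b set \<Rightarrow> 'b \<Rightarrow> 'b" where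
  "sum_proj Q B nb V x = (\<Sum>i\<in>{1..nb}. energy_proj Q (B i \<inter> V) x)"

text \<open>If \<open>V\<close> is \<open>{0}\<close>, every real constant satisfies the inequalities below, so that neither a
  largest nor a smallest one exists; these quantities are meaningful only for \<open>V \<noteq> {0}\<close>.\<close>

definition lambda_min ::
    "(('b::real_normed_vector \<Rightarrow>\<^sub>L real) \<Rightarrow> 'b) \<Rightarrow> 'b set \<Rightarrow> ('b \<Rightarrow> 'b) \<Rightarrow> real" where
  "lambda_min Q V P = (GREATEST c. \<forall>v\<in>V. c * (norm v)\<^sup>2 \<le> energy_inner Q v (P v))"

definition lambda_max ::
    "(('b::real_normed_vector \<Rightarrow>\<^sub>L real) \<Rightarrow> 'b) \<Rightarrow> 'b set \<Rightarrow> ('b \<Rightarrow> 'b) \<Rightarrow> real" where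
  "lambda_max Q V P = (LEAST c. \<forall>v\<in>V. energy_inner Q v (P v) \<le> c * (norm v)\<^sup>2)"

text \<open>The dual of a subspace \<open>S\<close> that is a set rather than a type: the continuous linear functionals
  on \<open>S\<close>, represented as functions that are \<open>undefined\<close> outside \<open>S\<close>, so that equality of functions
  is equality of functionals on \<open>S\<close>.\<close>

definition dual_on :: "'b::real_normed_vector set \<Rightarrow> ('b \<Rightarrow> real) set" where
  "dual_on S = {f \<in> extensional S.
     (\<forall>x\<in>S. \<forall>y\<in>S. f (x + y) = f x + f y) \<and>
     (\<forall>c. \<forall>x\<in>S. f (c *\<^sub>R x) = c * f x) \<and>
     (\<exists>K. \<forall>x\<in>S. \<bar>f x\<bar> \<le> K * norm x)}"

definition restrict_dual :: "'b::real_normed_vector set \<Rightarrow> ('b \<Rightarrow>\<^sub>L real) \<Rightarrow> 'b \<Rightarrow> real" where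
  "restrict_dual S f = restrict (blinfun_apply f) S"

text \<open>In the two suprema below the vector \<open>0 \<in> S\<close> contributes \<open>0 / 0 = 0\<close>, which does not affect
  the value, as in the library's \<open>onorm\<close>.\<close>

definition dual_norm_on :: "'b::real_normed_vector set \<Rightarrow> ('b \<Rightarrow> real) \<Rightarrow> real" where
  "dual_norm_on S f = (SUP \<psi>\<in>S. f \<psi> / norm \<psi>)"

definition onorm_on ::
    "'b::real_normed_vector set \<Rightarrow> ('b \<Rightarrow> 'c::real_normed_vector) \<Rightarrow> real" where
  "onorm_on S f = (SUP x\<in>S. norm (f x) / norm x)"

text \<open>\<open>T\<close> is the positive symmetric linear bijection from the dual of \<open>S\<close> onto \<open>S\<close> that represents
  the dual norm.\<close>

definition dual_norm_operator ::
    "'b::real_normed_vector set \<Rightarrow> (('b \<Rightarrow> real) \<Rightarrow> 'b) \<Rightarrow> bool" where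
  "dual_norm_operator S T \<longleftrightarrow>
     bij_betw T (dual_on S) S \<and>
     (\<forall>f\<in>dual_on S. \<forall>g\<in>dual_on S. T (\<lambda>x\<in>S. f x + g x) = T f + T g) \<and>
     (\<forall>c. \<forall>f\<in>dual_on S. T (\<lambda>x\<in>S. c * f x) = c *\<^sub>R T f) \<and>
     (\<forall>f\<in>dual_on S. \<forall>g\<in>dual_on S. f (T g) = g (T f)) \<and>
     (\<forall>f\<in>dual_on S. 0 \<le> f (T f)) \<and>
     (\<forall>f\<in>dual_on S. (dual_norm_on S f)\<^sup>2 = f (T f))"

text \<open>Continuity constants of \<open>L\<close> and its inverse, and of the induced bijections
  \<open>B i \<rightarrow> L ` B i\<close> and their inverses.\<close>

definition Cbar :: "('b::real_normed_vector \<Rightarrow> 'c::real_normed_vector) \<Rightarrow> (nat \<Rightarrow> 'b set) \<Rightarrow> nat \<Rightarrow> real" where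
  "Cbar L B nb = Max (insert (onorm L) ((\<lambda>i. onorm_on (B i) L) ` {1..nb}))"

definition Cbar_inv :: "('b::real_normed_vector \<Rightarrow> 'c::real_normed_vector) \<Rightarrow> (nat \<Rightarrow> 'b set) \<Rightarrow> nat \<Rightarrow> real" where
  "Cbar_inv L B nb =
     Max (insert (onorm (inv L)) ((\<lambda>i. onorm_on (L ` B i) (inv_into (B i) L)) ` {1..nb}))"

end

theory Submission
  imports Defs
begin

text \<open>Under the energy inner product, \<open>Q\<close> is the Riesz map, and by polarization
  \<open>Q\<^sub>i \<circ> R\<^sub>i \<circ> Q\<^sup>-\<^sup>1\<close> is the orthogonal projection \<open>E\<^sub>i\<close> onto \<open>B\<^sub>i\<close>.  For \<open>x \<in> V\<close>, the distance
  of \<open>x\<close> to \<open>Q \<Phi>\<close> is \<open>\<parallel>x\<parallel>\<close>, and the distance of \<open>E\<^sub>i x\<close> to \<open>E\<^sub>i Q \<Phi>\<close> is \<open>\<parallel>P\<^sub>i x\<parallel>\<close>, because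
  \<open>E\<^sub>i Q \<Phi>\<close> is the orthogonal complement of \<open>V \<inter> B\<^sub>i\<close> in \<open>B\<^sub>i\<close>.  Applying \<open>L\<close> changes squared
  distances by factors between \<open>1 / D\<^sup>2\<close> and \<open>C\<^sup>2\<close>, where \<open>C\<close> and \<open>D\<close> bound \<open>L\<close> and its inverse,
  and \<open>\<langle>x, P x\<rangle>\<close> is the sum of the \<open>\<parallel>P\<^sub>i x\<parallel>\<^sup>2\<close>.\<close>

section \<open>The bounded inverse theorem\<close>

text \<open>The closures of the images of the balls of radius \<open>n\<close> cover the target, so
  by Baire one of them contains a ball around some \<open>y\<close>. Subtracting approximate
  preimages of \<open>y\<close> and \<open>y + z\<close> handles small \<open>z\<close>; scaling
  handles the rest.\<close>

lemma banach_surj_approx: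
  fixes T :: "'a::banach \<Rightarrow> 'b::banach"
  assumes "bounded_linear T" "surj T"
  obtains K where "0 < K"
    "\<And>z d. 0 < d \<Longrightarrow> \<exists>x. norm x \<le> K * norm z \<and> norm (T x - z) < d"
proof -
  interpret T: bounded_linear T by fact
  define G where "G = range (\<lambda>n::nat. closure (T ` cball 0 (real n)))"
  have "\<Union>G = UNIV"
  proof -
    have "z \<in> \<Union>G" for z
    proof -
      obtain x where "z = T x" using \<open>surj T\<close> by (auto elim: surjE)
      moreover obtain n :: nat where "norm x \<le> real n"
        using real_arch_simple by blast
      ultimately have "z \<in> T ` cball 0 (real n)" by auto
      then show ?thesis
        using closure_subset[of "T ` cball 0 (real n)"] by (auto simp: G_def)
    qed
    then show ?thesis by blast
  qed
  then have ne: "euclidean interior_of \<Union>G \<noteq> {}" by simp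
  have "\<exists>S\<in>G. interior S \<noteq> {}"
  proof (rule ccontr)
    assume *: "\<not> ?thesis"
    have "euclidean interior_of \<Union>G = {}"
    proof (rule Baire_category_alt)
      show "countable G" by (simp add: G_def)
      show "closedin euclidean S \<and> euclidean interior_of S = {}" if "S \<in> G" for S
        using that * by (auto simp: G_def)
    qed (simp add: completely_metrizable_space_euclidean)
    with ne show False by contradiction
  qed
  then obtain n y where "y \<in> interior (closure (T ` cball 0 (real n)))"
    by (auto simp: G_def)
  then obtain e where "0 < e" and e: "ball y e \<subseteq> closure (T ` cball 0 (real n))"
    by (auto simp: mem_interior)
  have appr: "\<exists>x. norm x \<le> 2 * real n \<and> norm (T x - z) < d" if "norm z < e" "0 < d" for z d
  proof -
    have near: "\<exists>x. norm x \<le> real n \<and> dist (T x) w < d / 2" if "w \<in> ball y e" for w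
    proof -
      have "w \<in> closure (T ` cball 0 (real n))" using e that by blast
      then have "\<exists>t\<in>T ` cball 0 (real n). dist t w < d / 2"
        using half_gt_zero[OF \<open>0 < d\<close>] unfolding closure_approachable by blast
      then show ?thesis by auto
    qed
    obtain x1 x2 where x: "norm x1 \<le> real n" "dist (T x1) (y + z) < d / 2"
      "norm x2 \<le> real n" "dist (T x2) y < d / 2"
    proof -
      have "y + z \<in> ball y e" "y \<in> ball y e"
        using \<open>norm z < e\<close> \<open>0 < e\<close> by (auto simp: dist_norm)
      from near[OF this(1)] near[OF this(2)] show thesis using that by blast
    qed
    have "norm (x1 - x2) \<le> 2 * real n"
      using norm_triangle_ineq4[of x1 x2] x by simp
    moreover have "norm (T (x1 - x2) - z) < d"
    proof -
      have "T (x1 - x2) - z = (T x1 - (y + z)) - (T x2 - y)"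
        by (simp add: T.diff)
      also have "norm \<dots> \<le> norm (T x1 - (y + z)) + norm (T x2 - y)"
        by (rule norm_triangle_ineq4)
      also have "\<dots> < d" using x by (simp add: dist_norm)
      finally show ?thesis .
    qed
    ultimately show ?thesis by blast
  qed
  \<comment> \<open>Each \<open>z\<close> is rescaled to norm \<open>e / 2\<close>, where
    approximate preimages of norm at most \<open>2 * real n\<close> exist; the \<open>+ 1\<close>
    keeps \<open>K\<close> positive when \<open>n = 0\<close>.\<close>
  define K where "K = 2 * (2 * real n + 1) / e"
  have "0 < K" using \<open>0 < e\<close> by (simp add: K_def)
  moreover have "\<exists>x. norm x \<le> K * norm z \<and> norm (T x - z) < d" if "0 < d" for z d
  proof (cases "z = 0")
    case True
    then show ?thesis using that by (auto intro!: exI[of _ 0])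
  next
    case False
    define c where "c = e / (2 * norm z)"
    have "0 < c" using False \<open>0 < e\<close> by (simp add: c_def)
    have "norm (c *\<^sub>R z) < e" using False \<open>0 < e\<close> by (simp add: c_def)
    then obtain x where x: "norm x \<le> 2 * real n" "norm (T x - c *\<^sub>R z) < c * d"
      using appr \<open>0 < c\<close> \<open>0 < d\<close> by (metis mult_pos_pos)
    have "norm (x /\<^sub>R c) \<le> (2 * real n + 1) / c"
      using x \<open>0 < c\<close> by (simp add: divide_simps)
    also have "\<dots> = K * norm z"
      using False \<open>0 < e\<close> by (simp add: K_def c_def)
    finally have "norm (x /\<^sub>R c) \<le> K * norm z" .
    moreover have "T (x /\<^sub>R c) - z = (T x - c *\<^sub>R z) /\<^sub>R c"
      using \<open>0 < c\<close> by (simp add: T.scaleR scaleR_diff_right)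
    then have "norm (T (x /\<^sub>R c) - z) < d"
      using x \<open>0 < c\<close> by (simp add: divide_simps mult.commute)
    ultimately show ?thesis by blast
  qed
  ultimately show ?thesis using that by blast
qed

text \<open>Successive approximation: each correction halves the residual, so the corrections are
  dominated by a geometric series and, the domain being complete, sum to an exact preimage.\<close>

lemma banach_surj_bounded_preimage:
  fixes T :: "'a::banach \<Rightarrow> 'b::banach"
  assumes "bounded_linear T" "surj T"
  obtains K where "\<And>z. \<exists>x. T x = z \<and> norm x \<le> K * norm z"
proof -
  interpret T: bounded_linear T by fact
  obtain K where "0 < K"
    and K: "\<And>z d. 0 < d \<Longrightarrow> \<exists>x. norm x \<le> K * norm z \<and> norm (T x - z) < d"
    using banach_surj_approx[OF assms] by blast
  have "\<exists>x. norm x \<le> K * norm z \<and> norm (z - T x) \<le> norm z / 2" for z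
  proof (cases "z = 0")
    case False
    then show ?thesis
      using K[of "norm z / 2" z] by (auto simp: norm_minus_commute intro: less_imp_le)
  qed (auto intro!: exI[of _ 0])
  then obtain g where g: "\<And>z. norm (g z) \<le> K * norm z" "\<And>z. norm (z - T (g z)) \<le> norm z / 2"
    by metis
  have "\<exists>x. T x = z \<and> norm x \<le> (2 * K) * norm z" for z
  proof -
    \<comment> \<open>\<open>r n\<close> is the residual left after \<open>n\<close>
      corrections.\<close>
    define r where "r n = ((\<lambda>y. y - T (g y)) ^^ n) z" for n
    have r_Suc: "r (Suc n) = r n - T (g (r n))" for n by (simp add: r_def)
    have r_le: "norm (r n) \<le> norm z * (1 / 2) ^ n" for n
    proof (induction n)
      case (Suc n)
      then show ?case using g(2)[of "r n"] by (simp add: r_Suc)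
    qed (simp add: r_def)
    have gr_le: "norm (g (r n)) \<le> K * norm z * (1 / 2) ^ n" for n
      using order_trans[OF g(1) mult_left_mono[OF r_le]] \<open>0 < K\<close> by (simp add: mult.assoc)
    have geo: "(\<lambda>n. K * norm z * (1 / 2) ^ n) sums (K * norm z * 2)"
      using sums_mult[OF geometric_sums[of "1/2::real"], of "K * norm z"] by simp
    have sumg: "summable (\<lambda>n. g (r n))"
      using gr_le sums_summable[OF geo] by (rule summable_comparison_test'[where N = 0, rotated])
    have "norm (\<Sum>n. g (r n)) \<le> K * norm z * 2"
      using norm_suminf_le[OF gr_le sums_summable[OF geo]] sums_unique[OF geo] by simp
    moreover have "T (\<Sum>n. g (r n)) = z"
    proof -
      have "(\<lambda>n. norm z * (1 / 2) ^ n) \<longlonglongrightarrow> 0"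
        by (auto intro!: tendsto_eq_intros LIMSEQ_power_zero)
      then have "r \<longlonglongrightarrow> 0"
        by (rule Lim_null_comparison[OF always_eventually, rotated]) (use r_le in blast)
      \<comment> \<open>By \<open>r_Suc\<close> the terms are \<open>r n - r (Suc n)\<close>, so the
        sum is \<open>r 0 = z\<close> minus the limit 0.\<close>
      from telescope_sums'[OF this] have "(\<lambda>n. T (g (r n))) sums z"
        by (simp add: r_Suc) (simp add: r_def)
      moreover have "(\<lambda>n. T (g (r n))) sums T (\<Sum>n. g (r n))"
        using T.sums[OF summable_sums[OF sumg]] .
      ultimately show ?thesis by (metis sums_unique2)
    qed
    ultimately show ?thesis by (auto simp: mult_ac)
  qed
  then show ?thesis using that by blast
qed

text \<open>This makes \<open>onorm (inv L)\<close> a genuine bound for the inverse of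
  \<open>L\<close>.\<close>

lemma bounded_linear_inv:
  fixes T :: "'a::banach \<Rightarrow> 'b::banach"
  assumes "bounded_linear T" "bij T"
  shows "bounded_linear (inv T)"
proof -
  interpret T: bounded_linear T by fact
  have inv: "inv T (T x) = x" "T (inv T z) = z" for x z
    using \<open>bij T\<close> by (simp_all add: bij_is_inj bij_is_surj surj_f_inv_f)
  obtain K where K: "\<And>z. \<exists>x. T x = z \<and> norm x \<le> K * norm z"
    using banach_surj_bounded_preimage[OF assms(1) bij_is_surj[OF assms(2)]] by blast
  show ?thesis
  proof (rule bounded_linear_intro)
    show "inv T (x + y) = inv T x + inv T y" for x y by (metis inv T.add)
    show "inv T (c *\<^sub>R x) = c *\<^sub>R inv T x" for c x by (metis inv T.scaleR)
    show "norm (inv T x) \<le> norm x * K" for x using K[of x] inv by (auto simp: mult.commute)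
  qed
qed

section \<open>Orthogonality for a norm induced by an inner product\<close>

text \<open>The inner product is a parameter, because it comes from \<open>Q\<close> while the norm
  belongs to the type.\<close>

locale norm_inner =
  fixes ip :: "'a::real_normed_vector \<Rightarrow> 'a \<Rightarrow> real"
  assumes add_left: "ip (x + y) z = ip x z + ip y z"
    and scaleR_left: "ip (c *\<^sub>R x) z = c * ip x z"
    and commute: "ip x y = ip y x"
    and self: "ip x x = (norm x)\<^sup>2"
begin

lemma linear_left: "linear (\<lambda>x. ip x z)"
  by (rule linearI) (simp_all add: add_left scaleR_left)

lemma linear_right: "linear (ip z)"
  using linear_left[of z] by (simp add: commute[of _ z])

lemmas diff_left = linear_diff[OF linear_left]
  and add_right = linear_add[OF linear_right]
  and scaleR_right = linear_cmul[OF linear_right]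
  and diff_right = linear_diff[OF linear_right]
  and zero_left = linear_0[OF linear_left]
  and zero_right = linear_0[OF linear_right]

lemma Cauchy_Schwarz: "ip x y \<le> norm x * norm y"
proof (cases "y = 0")
  case False
  \<comment> \<open>The vector is the component of \<open>x\<close> orthogonal to \<open>y\<close>,
    multiplied by the square of \<open>norm y\<close> to avoid division.\<close>
  have "0 \<le> ip ((norm y)\<^sup>2 *\<^sub>R x - ip x y *\<^sub>R y) ((norm y)\<^sup>2 *\<^sub>R x - ip x y *\<^sub>R y)"
    by (simp add: self)
  also have "\<dots> = (norm y)\<^sup>2 * ((norm x * norm y)\<^sup>2 - (ip x y)\<^sup>2)"
    by (simp add: diff_left diff_right scaleR_left scaleR_right commute[of y x])
      (simp add: self algebra_simps power2_eq_square)
  finally have "(ip x y)\<^sup>2 \<le> (norm x * norm y)\<^sup>2"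
    using False by (simp add: zero_le_mult_iff)
  then show ?thesis by (rule power2_le_imp_le) simp
qed (simp add: zero_right)

text \<open>Gram-Schmidt by induction: with \<open>y\<close> and \<open>b\<close> the projections of
  \<open>x\<close> and the new vector \<open>a\<close> onto the old span, only a correction along
  \<open>a - b\<close> remains.\<close>

lemma ex_orthogonal_projection_span:
  assumes "finite F"
  shows "\<exists>y\<in>span F. \<forall>v\<in>span F. ip (x - y) v = 0"
proof -
  have "\<exists>y\<in>span F. \<forall>v\<in>F. ip (x - y) v = 0"
    using assms
  proof (induction F arbitrary: x rule: finite_induct)
    case (insert a F)
    obtain y where y: "y \<in> span F" "\<forall>v\<in>F. ip (x - y) v = 0" using insert.IH by blast
    obtain b where b: "b \<in> span F" "\<forall>v\<in>F. ip (a - b) v = 0" using insert.IH by blast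
    have sub: "span F \<subseteq> span (insert a F)" by (rule span_mono) auto
    have perp: "ip z b = 0" if "\<forall>v\<in>F. ip z v = 0" for z
      by (rule linear_eq_0_on_span[OF linear_right _ b(1)]) (use that in auto)
    \<comment> \<open>If \<open>a = b\<close>, then \<open>a\<close> is already in
      \<open>span F\<close>, the denominator is 0, and there is nothing to correct.\<close>
    define c where "c = ip (x - y) a / ip (a - b) (a - b)"
    show ?case
    proof (intro bexI ballI)
      show "y + c *\<^sub>R (a - b) \<in> span (insert a F)"
        using y(1) b(1) sub span_base[of a "insert a F"]
        by (intro span_add span_scale span_diff) auto
      have split: "ip (x - (y + c *\<^sub>R (a - b))) v = ip (x - y) v - c * ip (a - b) v" for v
        unfolding diff_diff_eq[symmetric] diff_left[of "x - y"] scaleR_left ..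
      fix v assume "v \<in> insert a F"
      then consider "v = a" | "v \<in> F" by blast
      then show "ip (x - (y + c *\<^sub>R (a - b))) v = 0"
      proof cases
        case 1
        have "ip (a - b) a = ip (a - b) (a - b)" using perp[OF b(2)] by (simp add: diff_right)
        moreover have "ip (x - y) a = 0" if "a = b" using perp[OF y(2)] that by simp
        ultimately show ?thesis
          unfolding \<open>v = a\<close> split by (cases "a = b") (simp_all add: c_def self zero_left)
      next
        case 2
        then show ?thesis
          unfolding split using y(2) b(2) by simp
      qed
    qed
  qed simp
  then show ?thesis
    by (meson linear_eq_0_on_span[OF linear_right])
qed

lemma orthogonal_projection_unique:
  assumes "subspace S" "y \<in> S" "z \<in> S"
    and "\<forall>v\<in>S. ip (x - y) v = 0" "\<forall>v\<in>S. ip (x - z) v = 0"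
  shows "y = z"
proof -
  have "y - z \<in> S" using assms by (simp add: subspace_diff)
  then have "ip (x - z) (y - z) - ip (x - y) (y - z) = 0" using assms by simp
  then have "ip (y - z) (y - z) = 0" by (simp add: diff_left)
  then show ?thesis by (simp add: self)
qed

text \<open>The functionals \<open>ip v\<close> on \<open>S\<close> have dual norm \<open>norm v\<close>, so by polarization \<open>T\<close> is a left
  inverse of \<open>v \<mapsto> ip v\<close>, hence, being injective, a two-sided one.  In particular the existence of
  \<open>T\<close> replaces the Riesz representation theorem on \<open>S\<close>.\<close>

lemma dual_norm_operator_represents:
  assumes S: "subspace S" and T: "dual_norm_operator S T"
    and f: "f \<in> dual_on S"
  shows "T f \<in> S" and "v \<in> S \<Longrightarrow> ip (T f) v = f v"
proof -
  note T' = T[unfolded dual_norm_operator_def]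
  have TS: "T g \<in> S" if "g \<in> dual_on S" for g
    using T' that bij_betw_apply[of T "dual_on S" S g] by blast
  then show "T f \<in> S" using f .
  define J where "J v = (\<lambda>x\<in>S. ip v x)" for v
  have J: "J v \<in> dual_on S" for v
  proof -
    have "\<bar>ip v x\<bar> \<le> norm v * norm x" for x
      using Cauchy_Schwarz[of v x] Cauchy_Schwarz[of "- v" x] linear_neg[OF linear_left, of v x]
      by simp
    then show ?thesis
      using S by (auto simp: dual_on_def J_def subspace_add subspace_scale add_right scaleR_right)
  qed
  have norm_J: "dual_norm_on S (J v) = norm v" if "v \<in> S" for v
    unfolding dual_norm_on_def
  proof (rule cSup_eq_maximum)
    show "norm v \<in> (\<lambda>\<psi>. J v \<psi> / norm \<psi>) ` S"
      by (rule image_eqI[OF _ that]) (use that in \<open>simp add: J_def self power2_eq_square\<close>)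
    show "c \<le> norm v" if "c \<in> (\<lambda>\<psi>. J v \<psi> / norm \<psi>) ` S" for c
      using that Cauchy_Schwarz by (auto simp: J_def divide_le_eq)
  qed
  define A where "A v = T (J v)" for v
  have AS: "A v \<in> S" for v using TS J by (simp add: A_def)
  have A_self: "ip v (A v) = (norm v)\<^sup>2" if "v \<in> S" for v
  proof -
    have "(dual_norm_on S (J v))\<^sup>2 = J v (T (J v))" using T' J by blast
    then show ?thesis using norm_J[OF that] AS[of v] by (simp add: J_def A_def)
  qed
  have A_sym: "ip u (A v) = ip v (A u)" for u v
  proof -
    have "J u (T (J v)) = J v (T (J u))" using T' J by blast
    then show ?thesis using AS[of u] AS[of v] by (simp add: J_def A_def)
  qed
  have A_add: "A (u + v) = A u + A v" for u v
  proof -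
    have "J (u + v) = (\<lambda>x\<in>S. J u x + J v x)"
      by (auto simp: J_def add_left restrict_def)
    then show ?thesis unfolding A_def using T' J by metis
  qed
  \<comment> \<open>On \<open>S\<close> the symmetric form \<open>ip u (A v)\<close> has the same
    quadratic form as \<open>ip\<close>, by \<open>A_self\<close> and \<open>A_sym\<close>;
    polarization identifies the two.\<close>
  have A_ip: "ip u (A v) = ip u v" if "u \<in> S" "v \<in> S" for u v
  proof -
    have "(norm (u + v))\<^sup>2 = (norm u)\<^sup>2 + 2 * ip u v + (norm v)\<^sup>2"
      by (simp add: self[symmetric] add_left add_right commute[of v u])
    then show ?thesis
      using A_self[OF subspace_add[OF S that]] A_self[OF that(1)] A_self[OF that(2)] A_sym[of u v]
      by (simp add: A_add add_left add_right)
  qed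
  have A_id: "A v = v" if "v \<in> S" for v
  proof -
    have "A v - v \<in> S" using S AS that by (simp add: subspace_diff)
    then have "ip (A v - v) (A v - v) = 0"
      using A_ip that by (simp add: diff_right)
    then show ?thesis by (simp add: self)
  qed
  have "J (T f) = f"
  proof (rule inj_onD)
    show "inj_on T (dual_on S)" using T' by (simp add: bij_betw_def)
    show "T (J (T f)) = T f" using A_id[OF TS[OF f]] by (simp add: A_def)
  qed (use J f in auto)
  then show "v \<in> S \<Longrightarrow> ip (T f) v = f v"
    by (metis J_def restrict_apply')
qed

text \<open>With \<open>E\<close> the orthogonal projection onto \<open>S\<close>, the projection of \<open>x\<close> onto the part of \<open>S\<close>
  orthogonal to \<open>span F\<close> is the remainder of \<open>E x\<close> after projecting it onto \<open>E ` span F\<close>.\<close>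

lemma projection_onto_complement:
  assumes S: "subspace S" and F: "finite F"
    and E: "\<And>x. E x \<in> S" "\<And>x v. v \<in> S \<Longrightarrow> ip (E x) v = ip x v"
  obtains w where "w \<in> span F" and "\<forall>u\<in>span F. ip u (E (x - w)) = 0"
    and "\<forall>v\<in>S. (\<forall>u\<in>span F. ip u v = 0) \<longrightarrow> ip (x - E (x - w)) v = 0"
proof -
  have unique: "E x = y" if "y \<in> S" "\<And>v. v \<in> S \<Longrightarrow> ip y v = ip x v" for x y
    by (rule orthogonal_projection_unique[OF S, where x = x])
      (use that E in \<open>simp_all add: diff_left\<close>)
  have linE: "linear E"
  proof (rule linearI)
    show "E (x + y) = E x + E y" for x y
      by (rule unique) (use S E in \<open>simp_all add: subspace_add add_left\<close>)
    show "E (c *\<^sub>R x) = c *\<^sub>R E x" for c x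
      by (rule unique) (use S E in \<open>simp_all add: subspace_scale scaleR_left\<close>)
  qed
  \<comment> \<open>The image of \<open>span F\<close> under the linear \<open>E\<close> is the span
    of a finite set, so \<open>E x\<close> has a projection onto it; \<open>w\<close> is chosen with
    \<open>E w\<close> equal to that projection.\<close>
  obtain w where w: "w \<in> span F" "\<forall>u\<in>span F. ip (E x - E w) (E u) = 0"
    using ex_orthogonal_projection_span[of "E ` F" "E x"] F
    by (auto simp: linear_span_image[OF linE])
  show ?thesis
  proof (rule that[OF w(1)])
    show "\<forall>u\<in>span F. ip u (E (x - w)) = 0"
      using w(2) E by (simp add: linear_diff[OF linE, symmetric] commute[of _ "E (x - w)"])
        (metis E commute)
    show "\<forall>v\<in>S. (\<forall>u\<in>span F. ip u v = 0) \<longrightarrow> ip (x - E (x - w)) v = 0"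
      using w(1) E by (simp add: diff_left)
  qed
qed

end

section \<open>Extremal constants\<close>

text \<open>\<open>LEAST\<close> on the reals is informative only if a least element exists. The
  admissible constants form a closed set, bounded below by the ratio at \<open>v\<close>, so their
  infimum is attained.\<close>

lemma Least_ratio_bound:
  fixes a n :: "'a \<Rightarrow> real"
  assumes "v \<in> V" "0 < n v" and K: "\<forall>v\<in>V. a v \<le> K * n v"
  shows "(LEAST c. \<forall>v\<in>V. a v \<le> c * n v) \<le> K"
proof -
  let ?S = "{c. \<forall>v\<in>V. a v \<le> c * n v}"
  have "bdd_below ?S"
    by (rule bdd_belowI[of _ "a v / n v"]) (use assms in \<open>auto simp: divide_le_eq\<close>)
  moreover have "?S = (\<Inter>v\<in>V. {c. a v \<le> c * n v})" by auto
  then have "closed ?S"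
    by (auto intro!: closed_INT closed_Collect_le continuous_intros simp del: INT_extend_simps)
  ultimately have "Inf ?S \<in> ?S" using K by (intro closed_contains_Inf) auto
  then have "Least (\<lambda>c. c \<in> ?S) = Inf ?S"
    by (rule Least_equality) (use \<open>bdd_below ?S\<close> in \<open>auto intro: cInf_lower\<close>)
  moreover have "Inf ?S \<le> K" using K \<open>bdd_below ?S\<close> by (intro cInf_lower) auto
  ultimately show ?thesis by simp
qed

lemma Greatest_ratio_bound:
  fixes a n :: "'a \<Rightarrow> real"
  assumes "v \<in> V" "0 < n v" and K: "\<forall>v\<in>V. K * n v \<le> a v"
  shows "K \<le> (GREATEST c. \<forall>v\<in>V. c * n v \<le> a v)"
proof -
  let ?S = "{c. \<forall>v\<in>V. c * n v \<le> a v}"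
  have "bdd_above ?S"
    by (rule bdd_aboveI[of _ "a v / n v"]) (use assms in \<open>auto simp: le_divide_eq\<close>)
  moreover have "?S = (\<Inter>v\<in>V. {c. c * n v \<le> a v})" by auto
  then have "closed ?S"
    by (auto intro!: closed_INT closed_Collect_le continuous_intros simp del: INT_extend_simps)
  ultimately have "Sup ?S \<in> ?S" using K by (intro closed_contains_Sup) auto
  then have "Greatest (\<lambda>c. c \<in> ?S) = Sup ?S"
    by (rule Greatest_equality) (use \<open>bdd_above ?S\<close> in \<open>auto intro: cSup_upper\<close>)
  moreover have "K \<le> Sup ?S" using K \<open>bdd_above ?S\<close> by (intro cSup_upper) auto
  ultimately show ?thesis by simp
qed

section \<open>The spectral bounds\<close>

theorem theorem6p10:
  fixes Q :: "('b::banach \<Rightarrow>\<^sub>L real) \<Rightarrow> 'b"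
    and \<phi> :: "nat \<Rightarrow> nat \<Rightarrow> ('b \<Rightarrow>\<^sub>L real)"
    and nb na :: nat
    and B :: "nat \<Rightarrow> 'b set"
    and Qs :: "nat \<Rightarrow> ('b \<Rightarrow> real) \<Rightarrow> 'b"
    and L :: "'b \<Rightarrow> 'c::banach"
    and Cmin Cmax :: real
  defines "\<Phi> \<equiv> measurement_span \<phi> nb na"
    and "V \<equiv> measurement_kernel \<phi> nb na"
  defines "P \<equiv> sum_proj Q B nb V"
  assumes reflexive: "reflexive_space TYPE('b)"
    and separable: "\<exists>D::'b set. countable D \<and> closure D = UNIV"
    and Q_linear: "linear Q"
    and Q_bij: "bij Q"
    and Q_symmetric: "\<And>f g. blinfun_apply f (Q g) = blinfun_apply g (Q f)"
    and Q_positive: "\<And>f. 0 \<le> blinfun_apply f (Q f)"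
    and Q_norm: "\<And>u. (norm u)\<^sup>2 = blinfun_apply (inv Q u) u"
    and phi_distinct: "inj_on (\<lambda>(i, a). \<phi> i a) ({1..nb} \<times> {1..na})"
    and phi_independent: "independent ((\<lambda>(i, a). \<phi> i a) ` ({1..nb} \<times> {1..na}))"
    and B_subspace: "\<And>i. i \<in> {1..nb} \<Longrightarrow> subspace (B i)"
    and B_closed: "\<And>i. i \<in> {1..nb} \<Longrightarrow> closed (B i)"
    and B_sum: "\<And>x. \<exists>u. (\<forall>i\<in>{1..nb}. u i \<in> B i) \<and> x = (\<Sum>i\<in>{1..nb}. u i)"
    and B_biorthogonal: "\<And>i a. i \<in> {1..nb} \<Longrightarrow> a \<in> {1..na} \<Longrightarrow>
          \<exists>\<psi>\<in>B i. \<forall>j\<in>{1..nb}. \<forall>b\<in>{1..na}.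
            blinfun_apply (\<phi> j b) \<psi> = (if i = j \<and> a = b then 1 else 0)"
    and V_nontrivial: "V \<noteq> {0}"
    and Qs_operator: "\<And>i. i \<in> {1..nb} \<Longrightarrow> dual_norm_operator (B i) (Qs i)"
    and L_continuous: "bounded_linear L"
    and L_bij: "bij L"
    and Cmin_pos: "0 < Cmin"
    and Cmax_pos: "0 < Cmax"
    and lower: "\<And>f. Cmin * (INF g\<in>\<Phi>. (norm (L (Q (f - g))))\<^sup>2)
          \<le> (\<Sum>i\<in>{1..nb}. INF g\<in>\<Phi>. (norm (L (Qs i (restrict_dual (B i) (f - g)))))\<^sup>2)"
    and upper: "\<And>f. (\<Sum>i\<in>{1..nb}. INF g\<in>\<Phi>. (norm (L (Qs i (restrict_dual (B i) (f - g)))))\<^sup>2)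
          \<le> Cmax * (INF g\<in>\<Phi>. (norm (L (Q (f - g))))\<^sup>2)"
  shows "lambda_max Q V P \<le> (Cbar L B nb * Cbar_inv L B nb)\<^sup>2 * Cmax \<and>
         Cmin / (Cbar L B nb * Cbar_inv L B nb)\<^sup>2 \<le> lambda_min Q V P"
proof -

  \<comment> \<open>The energy inner product, and \<open>V\<close> as an orthogonal
    complement\<close>
  let ?F = "(\<lambda>(i, a). \<phi> i a) ` ({1..nb} \<times> {1..na})"
  let ?ip = "energy_inner Q"
  let ?I = "{1..nb}"
  have inv: "inv Q (Q f) = f" "Q (inv Q x) = x" for f x
    using Q_bij by (simp_all add: bij_is_inj bij_is_surj surj_f_inv_f)
  have ip_Q: "?ip (Q f) x = blinfun_apply f x" for f x
    by (simp add: energy_inner_def inv)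
  have inv_add: "inv Q (x + y) = inv Q x + inv Q y" for x y
    by (metis inv linear_add[OF Q_linear])
  have inv_scale: "inv Q (c *\<^sub>R x) = c *\<^sub>R inv Q x" for c x
    by (metis inv linear_cmul[OF Q_linear])
  interpret norm_inner ?ip
  proof
    show "?ip (x + y) z = ?ip x z + ?ip y z" for x y z
      by (simp add: energy_inner_def inv_add blinfun.add_left)
    show "?ip (c *\<^sub>R x) z = c * ?ip x z" for c x z
      by (simp add: energy_inner_def inv_scale blinfun.scaleR_left)
    show "?ip x y = ?ip y x" for x y
      using Q_symmetric[of "inv Q x" "inv Q y"] by (simp add: energy_inner_def inv)
    show "?ip x x = (norm x)\<^sup>2" for x
      by (simp add: energy_inner_def Q_norm)
  qed
  have QPhi: "span (Q ` ?F) = Q ` \<Phi>"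
    unfolding \<Phi>_def measurement_span_def by (rule linear_span_image[OF Q_linear])
  have V: "V = {x. \<forall>u\<in>span (Q ` ?F). ?ip u x = 0}"
  proof (intro subset_antisym subsetI CollectI ballI)
    fix x u assume "x \<in> V" "u \<in> span (Q ` ?F)"
    show "?ip u x = 0"
      by (rule linear_eq_0_on_span[OF linear_left _ \<open>u \<in> _\<close>])
        (use \<open>x \<in> V\<close> in \<open>auto simp: V_def measurement_kernel_def ip_Q\<close>)
  next
    fix x assume x: "x \<in> {x. \<forall>u\<in>span (Q ` ?F). ?ip u x = 0}"
    have "blinfun_apply (\<phi> i a) x = 0" if "i \<in> ?I" "a \<in> {1..na}" for i a
    proof -
      have "Q (\<phi> i a) \<in> span (Q ` ?F)"
        using that by (intro span_base imageI) force
      then show ?thesis using x by (simp flip: ip_Q)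
    qed
    then show "x \<in> V" by (simp add: V_def measurement_kernel_def)
  qed
  have V_perp: "?ip u x = 0" "?ip x u = 0" if "x \<in> V" "u \<in> Q ` \<Phi>" for x u
    using that V QPhi commute[of x u] by auto
  have subV: "subspace V"
    unfolding V by (rule subspaceI) (auto simp: zero_right add_right scaleR_right)
  have Phi0: "0 \<in> \<Phi>" by (simp add: \<Phi>_def measurement_span_def span_zero)

  \<comment> \<open>Continuity constants of \<open>L\<close>\<close>
  define C where "C = Cbar L B nb"
  define D where "D = Cbar_inv L B nb"
  have "onorm L \<le> C" unfolding C_def Cbar_def by (rule Max_ge) auto
  then have C: "norm (L x) \<le> C * norm x" for x
    using onorm[OF L_continuous, of x] mult_right_mono[of "onorm L" C "norm x"] by simp
  have "onorm (inv L) \<le> D" unfolding D_def Cbar_inv_def by (rule Max_ge) auto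
  then have D: "norm x \<le> D * norm (L x)" for x
    using onorm[OF bounded_linear_inv[OF L_continuous L_bij], of "L x"]
      mult_right_mono[of "onorm (inv L)" D "norm (L x)"] bij_is_inj[OF L_bij]
    by simp
  \<comment> \<open>A nonzero vector forces both constants to be positive, and later ensures that
    the extremal constants exist.\<close>
  obtain v0 where v0: "v0 \<in> V" "v0 \<noteq> 0"
    using V_nontrivial subspace_0[OF subV] by blast
  have "0 < C"
  proof -
    have "0 < norm v0" using v0 by simp
    also have "norm v0 \<le> D * norm (L v0)" by (rule D)
    finally have "0 < norm (L v0)" by (auto simp: zero_less_mult_iff)
    also have "\<dots> \<le> C * norm v0" by (rule C)
    finally show ?thesis by (auto simp: zero_less_mult_iff)
  qed
  have "0 < D"
  proof -
    have "0 < norm v0" using v0 by simp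
    also have "norm v0 \<le> D * norm (L v0)" by (rule D)
    finally show ?thesis by (auto simp: zero_less_mult_iff)
  qed
  have C2: "(norm (L x))\<^sup>2 \<le> C\<^sup>2 * (norm x)\<^sup>2" for x
    using power_mono[OF C, of x 2] by (simp add: power_mult_distrib)
  have D2: "(norm x)\<^sup>2 / D\<^sup>2 \<le> (norm (L x))\<^sup>2" for x
    using power_mono[OF D, of x 2] \<open>0 < D\<close>
    by (simp add: power_mult_distrib divide_le_eq mult.commute)

  \<comment> \<open>Orthogonal projections onto \<open>B i\<close> and onto its intersection with
    \<open>V\<close>\<close>
  define E where "E i x = Qs i (restrict_dual (B i) (inv Q x))" for i x
  have rd: "restrict_dual (B i) f \<in> dual_on (B i)" if "i \<in> ?I" for i f
    using B_subspace[OF that]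
    by (auto simp: restrict_dual_def dual_on_def subspace_add subspace_scale blinfun.add_right
        blinfun.scaleR_right intro!: exI[of _ "norm f"])
      (metis norm_blinfun real_norm_def)
  have E: "E i x \<in> B i" "v \<in> B i \<Longrightarrow> ?ip (E i x) v = ?ip x v" if "i \<in> ?I" for i x v
    using dual_norm_operator_represents[OF B_subspace[OF that] Qs_operator[OF that] rd[OF that]]
    by (auto simp: E_def restrict_dual_def energy_inner_def)
  \<comment> \<open>This rewrites the local terms of \<open>lower\<close> and \<open>upper\<close>
    at \<open>f = inv Q x\<close> as projections of \<open>x - Q g\<close>.\<close>
  have E_Qs: "E i (x - Q g) = Qs i (restrict_dual (B i) (inv Q x - g))" for i x g
  proof -
    have "inv Q (x - Q g) = inv Q x - g"
      by (metis inv linear_diff[OF Q_linear])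
    then show ?thesis by (simp add: E_def)
  qed
  let ?p = "\<lambda>i. energy_proj Q (B i \<inter> V)"
  \<comment> \<open>Besides justifying the \<open>THE\<close> in \<open>energy_proj\<close>, this
    yields a \<open>g\<close> for which the projection of \<open>x - Q g\<close> onto
    \<open>B i\<close> is exactly \<open>?p i x\<close>.\<close>
  have p: "?p i x \<in> B i \<inter> V" "\<And>v. v \<in> B i \<inter> V \<Longrightarrow> ?ip (x - ?p i x) v = 0"
    "\<exists>g\<in>\<Phi>. E i (x - Q g) = ?p i x" if i: "i \<in> ?I" for i x
  proof -
    have sub: "subspace (B i \<inter> V)"
      using B_subspace[OF i] subV by (rule subspace_inter)
    obtain w where w: "w \<in> span (Q ` ?F)" "\<forall>u\<in>span (Q ` ?F). ?ip u (E i (x - w)) = 0"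
      "\<forall>v\<in>B i. (\<forall>u\<in>span (Q ` ?F). ?ip u v = 0) \<longrightarrow> ?ip (x - E i (x - w)) v = 0"
      using projection_onto_complement[OF B_subspace[OF i], of "Q ` ?F" "E i" x] E[OF i]
      by auto
    then have proj: "E i (x - w) \<in> B i \<inter> V" "\<forall>v\<in>B i \<inter> V. ?ip (x - E i (x - w)) v = 0"
      using E[OF i] by (auto simp: V)
    have eq: "?p i x = E i (x - w)"
      unfolding energy_proj_def
      by (rule the_equality) (use proj orthogonal_projection_unique[OF sub] in blast)+
    show "?p i x \<in> B i \<inter> V" "\<And>v. v \<in> B i \<inter> V \<Longrightarrow> ?ip (x - ?p i x) v = 0"
      using proj by (auto simp: eq)
    show "\<exists>g\<in>\<Phi>. E i (x - Q g) = ?p i x" using w(1) unfolding QPhi eq by blast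
  qed
  have ip_p: "?ip x (?p i x) = (norm (?p i x))\<^sup>2" if "i \<in> ?I" for i x
    using p(2)[OF that p(1)[OF that], of x x] by (simp add: diff_left self)
  \<comment> \<open>Pairing with \<open>?p i x\<close> removes \<open>Q g\<close>, since
    \<open>?p i x\<close> lies in \<open>V\<close>; Cauchy-Schwarz then bounds every competitor from
    below.\<close>
  have p_le: "norm (?p i x) \<le> norm (E i (x - Q g))" if "i \<in> ?I" "g \<in> \<Phi>" for i x g
  proof -
    have mem: "?p i x \<in> B i" "?p i x \<in> V" using p(1)[OF that(1)] by auto
    have "(norm (?p i x))\<^sup>2 = ?ip (x - Q g) (?p i x)"
      using V_perp(1)[OF mem(2)] that(2) by (simp add: diff_left ip_p[OF that(1)])
    also have "\<dots> = ?ip (E i (x - Q g)) (?p i x)"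
      using E(2)[OF that(1) mem(1)] by simp
    also have "\<dots> \<le> norm (E i (x - Q g)) * norm (?p i x)" by (rule Cauchy_Schwarz)
    finally show ?thesis
      by (cases "?p i x = 0") (simp_all add: power2_eq_square)
  qed
  have ip_P: "?ip x (P x) = (\<Sum>i\<in>?I. (norm (?p i x))\<^sup>2)" for x
    unfolding P_def sum_proj_def linear_sum[OF linear_right]
    by (rule sum.cong) (simp_all add: ip_p)

  \<comment> \<open>Bounds on the infima and conclusion\<close>
  let ?s = "\<lambda>i x. INF g\<in>\<Phi>. (norm (L (Qs i (restrict_dual (B i) (inv Q x - g)))))\<^sup>2"
  let ?t = "\<lambda>x. INF g\<in>\<Phi>. (norm (L (Q (inv Q x - g))))\<^sup>2"
  have bdd: "bdd_below ((\<lambda>g. (norm (h g :: 'c))\<^sup>2) ` \<Phi>)" for h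
    by (rule bdd_belowI[of _ 0]) auto
  have s_ge: "(norm (?p i x))\<^sup>2 / D\<^sup>2 \<le> ?s i x" if "i \<in> ?I" for i x
  proof (rule cINF_greatest)
    fix g assume "g \<in> \<Phi>"
    have "(norm (?p i x))\<^sup>2 / D\<^sup>2 \<le> (norm (E i (x - Q g)))\<^sup>2 / D\<^sup>2"
      using p_le[OF that \<open>g \<in> \<Phi>\<close>] by (intro divide_right_mono power_mono) auto
    also have "\<dots> \<le> (norm (L (E i (x - Q g))))\<^sup>2" by (rule D2)
    finally show "(norm (?p i x))\<^sup>2 / D\<^sup>2 \<le> (norm (L (Qs i (restrict_dual (B i) (inv Q x - g)))))\<^sup>2"
      by (simp add: E_Qs)
  qed (use Phi0 in auto)
  have s_le: "?s i x \<le> C\<^sup>2 * (norm (?p i x))\<^sup>2" if "i \<in> ?I" for i x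
  proof -
    obtain g where g: "g \<in> \<Phi>" "E i (x - Q g) = ?p i x" using p(3)[OF \<open>i \<in> ?I\<close>] by blast
    have "?s i x \<le> (norm (L (E i (x - Q g))))\<^sup>2"
      unfolding E_Qs by (rule cINF_lower[OF bdd g(1)])
    also have "\<dots> \<le> C\<^sup>2 * (norm (?p i x))\<^sup>2" unfolding g(2) by (rule C2)
    finally show ?thesis .
  qed
  have t_ge: "(norm x)\<^sup>2 / D\<^sup>2 \<le> ?t x" if "x \<in> V" for x
  proof (rule cINF_greatest)
    fix g assume "g \<in> \<Phi>"
    then have "?ip x (Q g) = 0" "?ip (Q g) x = 0" using V_perp[OF that] by auto
    \<comment> \<open>Pythagoras: \<open>x\<close> is orthogonal to \<open>Q g\<close>.\<close>
    then have "(norm (x - Q g))\<^sup>2 = (norm x)\<^sup>2 + (norm (Q g))\<^sup>2"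
      by (simp add: self[symmetric] diff_left diff_right)
    then have "(norm x)\<^sup>2 / D\<^sup>2 \<le> (norm (x - Q g))\<^sup>2 / D\<^sup>2"
      by (intro divide_right_mono) auto
    also have "\<dots> \<le> (norm (L (x - Q g)))\<^sup>2" by (rule D2)
    finally show "(norm x)\<^sup>2 / D\<^sup>2 \<le> (norm (L (Q (inv Q x - g))))\<^sup>2"
      by (simp add: linear_diff[OF Q_linear] inv)
  qed (use Phi0 in auto)
  have t_le: "?t x \<le> C\<^sup>2 * (norm x)\<^sup>2" for x
  proof -
    \<comment> \<open>The competitor is \<open>g = 0\<close>.\<close>
    have "?t x \<le> (norm (L (Q (inv Q x - 0))))\<^sup>2" by (rule cINF_lower[OF bdd Phi0])
    also have "\<dots> \<le> C\<^sup>2 * (norm x)\<^sup>2" using C2[of x] by (simp add: inv)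
    finally show ?thesis .
  qed
  have up: "?ip x (P x) \<le> (C * D)\<^sup>2 * Cmax * (norm x)\<^sup>2" for x
  proof -
    have "?ip x (P x) / D\<^sup>2 \<le> (\<Sum>i\<in>?I. ?s i x)"
      unfolding ip_P sum_divide_distrib by (rule sum_mono) (rule s_ge)
    also have "\<dots> \<le> Cmax * ?t x" by (rule upper)
    also have "\<dots> \<le> Cmax * (C\<^sup>2 * (norm x)\<^sup>2)"
      using t_le Cmax_pos by (intro mult_left_mono) auto
    finally show ?thesis
      using \<open>0 < D\<close> by (simp add: divide_le_eq power_mult_distrib mult_ac)
  qed
  have lo: "Cmin / (C * D)\<^sup>2 * (norm x)\<^sup>2 \<le> ?ip x (P x)" if "x \<in> V" for x
  proof -
    have "Cmin * ((norm x)\<^sup>2 / D\<^sup>2) \<le> Cmin * ?t x"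
      using t_ge[OF that] Cmin_pos by (intro mult_left_mono) auto
    also have "\<dots> \<le> (\<Sum>i\<in>?I. ?s i x)" by (rule lower)
    also have "\<dots> \<le> C\<^sup>2 * ?ip x (P x)"
      unfolding ip_P sum_distrib_left by (rule sum_mono) (rule s_le)
    finally show ?thesis
      using \<open>0 < C\<close> \<open>0 < D\<close> by (simp add: field_simps power_mult_distrib)
  qed
  have "0 < (norm v0)\<^sup>2" using v0 by simp
  then show ?thesis
    unfolding lambda_max_def lambda_min_def C_def[symmetric] D_def[symmetric]
    using up lo by (intro conjI Least_ratio_bound[OF v0(1)] Greatest_ratio_bound[OF v0(1)]) auto
qed

end
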